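(* Let $E$ be an elliptic curve defined over $\mathbb{Q}$ with a rational point of order $3$ such that $\sqrt{\Delta(E)}\in\mathbb{Q}$. Then there exist $a,b,c,d\in\mathbb{Z}$ such that $E$ is $\mathbb{Q}$-isomorphic to either $E^{(1)}(a,b,c,d)$ or $E^{(2)}(a,b,c,d)$.
   Context: For a short Weierstrass model $Y^2=X^3+AX+B$ ($A,B\in\mathbb{Z}$) of $E$, $\Delta(E)=-2^4(4A^3+27B^2)$; whether $\Delta(E)$ is a square in $\mathbb{Q}$ (written $\sqrt{\Delta(E)}\in\mathbb{Q}$) does not depend on the chosen short model. For $a,b,c,d\in\mathbb{Z}$ put $$M=a^2+ab+b^2,\quad N=c^2+cd+d^2,\quad T=a^3d+3a^2bc+3a^2bd+3ab^2c-b^3d.$$ For $i=1,2$ let $E^{(i)}(a,b,c,d)$ be the curve $Y^2=P^{(i)}(a,b,c,d)(X)$, where $$P^{(1)}(a,b,c,d)(X)=X^3-9N^3M\,(3NM^3-2T^2)\,X+9N^4\,(6N^2M^6-6NM^3T^2+T^4),$$ $$P^{(2)}(a,b,c,d)(X)=X^3-3N^3M\,(NM^3+6T^2)\,X-N^4\,(2N^2M^6-30NM^3T^2-9T^4).$$ Some parameter values give singular cubics; "$E$ is $\mathbb{Q}$-isomorphic to" a member of a family means that the member is nonsingular and isomorphic to $E$ over $\mathbb{Q}$. *)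

theory Defs
  imports Complex_Main
begin

datatype weierstrass_curve = Weierstrass
  (a1: rat) (a2: rat) (a3: rat) (a4: rat) (a6: rat)

definition weierstrass_eqn :: "weierstrass_curve \<Rightarrow> rat \<Rightarrow> rat \<Rightarrow> rat" where
  "weierstrass_eqn E x y =
     y^2 + a1 E * x * y + a3 E * y - (x^3 + a2 E * x^2 + a4 E * x + a6 E)"

definition discriminant :: "weierstrass_curve \<Rightarrow> rat" where
  "discriminant E =
    (let b2 = a1 E^2 + 4 * a2 E;
         b4 = 2 * a4 E + a1 E * a3 E;
         b6 = a3 E^2 + 4 * a6 E;
         b8 = a1 E^2 * a6 E + 4 * a2 E * a6 E - a1 E * a3 E * a4 E + a2 E * a3 E^2 - a4 E^2
     in - (b2^2) * b8 - 8 * b4^3 - 27 * b6^2 + 9 * b2 * b4 * b6)"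

definition elliptic_curve :: "weierstrass_curve \<Rightarrow> bool" where
  "elliptic_curve E \<longleftrightarrow> discriminant E \<noteq> 0"

text \<open>
  Isomorphisms over the rationals between Weierstrass curves, preserving the point at infinity,
  are the admissible changes of variables. Since the field of rationals is infinite, the pointwise
  identity below is an identity of polynomials in \<open>x\<close> and \<open>y\<close>.
\<close>

definition Q_isomorphic :: "weierstrass_curve \<Rightarrow> weierstrass_curve \<Rightarrow> bool" where
  "Q_isomorphic E E' \<longleftrightarrow> (\<exists>u r s t. u \<noteq> 0 \<and>
     (\<forall>x y. weierstrass_eqn E (u^2 * x + r) (u^3 * y + s * u^2 * x + t)
              = u^6 * weierstrass_eqn E' x y))"

datatype point = Infinity | Affine rat rat

definition rational_points :: "weierstrass_curve \<Rightarrow> point set" where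
  "rational_points E = insert Infinity {Affine x y |x y. weierstrass_eqn E x y = 0}"

fun point_add :: "weierstrass_curve \<Rightarrow> point \<Rightarrow> point \<Rightarrow> point" where
  "point_add E Infinity Q = Q"
| "point_add E P Infinity = P"
| "point_add E (Affine x1 y1) (Affine x2 y2) =
    (if x1 = x2 \<and> y1 + y2 + a1 E * x2 + a3 E = 0 then Infinity
     else
      let l = (if x1 = x2
               then (3 * x1^2 + 2 * a2 E * x1 + a4 E - a1 E * y1) / (2 * y1 + a1 E * x1 + a3 E)
               else (y2 - y1) / (x2 - x1));
          n = y1 - l * x1;
          x3 = l^2 + a1 E * l - a2 E - x1 - x2
      in Affine x3 (- (l + a1 E) * x3 - n - a3 E))"

definition point_multiple :: "weierstrass_curve \<Rightarrow> nat \<Rightarrow> point \<Rightarrow> point" where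
  "point_multiple E n P = (point_add E P ^^ n) Infinity"

definition has_order :: "weierstrass_curve \<Rightarrow> point \<Rightarrow> nat \<Rightarrow> bool" where
  "has_order E P n \<longleftrightarrow> 0 < n \<and> point_multiple E n P = Infinity \<and>
     (\<forall>m. 0 < m \<and> m < n \<longrightarrow> point_multiple E m P \<noteq> Infinity)"

definition short_weierstrass :: "int \<Rightarrow> int \<Rightarrow> weierstrass_curve" where
  "short_weierstrass A B = Weierstrass 0 0 0 (of_int A) (of_int B)"

definition short_disc :: "int \<Rightarrow> int \<Rightarrow> int" where
  "short_disc A B = - (2^4) * (4 * A^3 + 27 * B^2)"

text \<open>
  The discriminant of \<open>E\<close> is taken on an integral short model. Such a model exists, and the choice
  does not matter: see \<open>sqrt_disc_rational_short\<close> and \<open>sqrt_disc_rational_iff\<close> below.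
\<close>

definition sqrt_disc_rational :: "weierstrass_curve \<Rightarrow> bool" where
  "sqrt_disc_rational E \<longleftrightarrow> (\<exists>A B. Q_isomorphic E (short_weierstrass A B) \<and>
     (\<exists>q::rat. q^2 = of_int (short_disc A B)))"

definition M_form :: "int \<Rightarrow> int \<Rightarrow> int" where
  "M_form a b = a^2 + a * b + b^2"

definition N_form :: "int \<Rightarrow> int \<Rightarrow> int" where
  "N_form c d = c^2 + c * d + d^2"

definition T_form :: "int \<Rightarrow> int \<Rightarrow> int \<Rightarrow> int \<Rightarrow> int" where
  "T_form a b c d = a^3 * d + 3 * a^2 * b * c + 3 * a^2 * b * d + 3 * a * b^2 * c - b^3 * d"

definition E1 :: "int \<Rightarrow> int \<Rightarrow> int \<Rightarrow> int \<Rightarrow> weierstrass_curve" where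
  "E1 a b c d =
    (let M = M_form a b; N = N_form c d; T = T_form a b c d
     in short_weierstrass
          (- (9 * N^3 * M * (3 * N * M^3 - 2 * T^2)))
          (9 * N^4 * (6 * N^2 * M^6 - 6 * N * M^3 * T^2 + T^4)))"

definition E2 :: "int \<Rightarrow> int \<Rightarrow> int \<Rightarrow> int \<Rightarrow> weierstrass_curve" where
  "E2 a b c d =
    (let M = M_form a b; N = N_form c d; T = T_form a b c d
     in short_weierstrass
          (- (3 * N^3 * M * (N * M^3 + 6 * T^2)))
          (- (N^4 * (2 * N^2 * M^6 - 30 * N * M^3 * T^2 - 9 * T^4))))"

lemma discriminant_short: "discriminant (short_weierstrass A B) = of_int (short_disc A B)"
  by (simp add: discriminant_def short_weierstrass_def short_disc_def Let_def algebra_simps power2_eq_square)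

lemma Q_isomorphic_discriminant:
  assumes "Q_isomorphic E E'"
  shows "\<exists>u. u \<noteq> 0 \<and> discriminant E = u^12 * discriminant E'"
proof -
  obtain u r s t where u: "u \<noteq> 0" and
    h: "\<And>x y. weierstrass_eqn E (u^2 * x + r) (u^3 * y + s * u^2 * x + t)
              = u^6 * weierstrass_eqn E' x y"
    using assms unfolding Q_isomorphic_def by blast
  obtain A1 A2 A3 A4 A6 where E: "E = Weierstrass A1 A2 A3 A4 A6" by (cases E)
  obtain C1 C2 C3 C4 C6 where E': "E' = Weierstrass C1 C2 C3 C4 C6" by (cases E')
  have h': "(u^3*y + s*u^2*x + t)^2 + A1*(u^2*x + r)*(u^3*y + s*u^2*x + t) + A3*(u^3*y + s*u^2*x + t)
        - ((u^2*x + r)^3 + A2*(u^2*x + r)^2 + A4*(u^2*x + r) + A6)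
      = u^6 * (y^2 + C1*x*y + C3*y - (x^3 + C2*x^2 + C4*x + C6))" for x y
    using h[of x y] unfolding weierstrass_eqn_def E E' weierstrass_curve.sel .
  define k6 where "k6 = u^6 * C6 - (A6 + r*A4 + r^2*A2 + r^3 - t*A3 - t^2 - r*t*A1)"
  define k3 where "k3 = u^3 * (A3 + r*A1 + 2*t) - u^6 * C3"
  define k4 where "k4 = u^6 * C4 - u^2 * (A4 - s*A3 + 2*r*A2 - (t + r*s)*A1 + 3*r^2 - 2*s*t)"
  define k2 where "k2 = u^6 * C2 - u^4 * (A2 - s*A1 + 3*r - s^2)"
  define k1 where "k1 = u^5 * (A1 + 2*s) - u^6 * C1"
  have k: "k6 + k3*y + k4*x + k2*x^2 + k1*(x*y) = 0" for x y
  proof -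
    have "k6 + k3*y + k4*x + k2*x^2 + k1*(x*y) =
        (u^3*y + s*u^2*x + t)^2 + A1*(u^2*x + r)*(u^3*y + s*u^2*x + t) + A3*(u^3*y + s*u^2*x + t)
        - ((u^2*x + r)^3 + A2*(u^2*x + r)^2 + A4*(u^2*x + r) + A6)
        - u^6 * (y^2 + C1*x*y + C3*y - (x^3 + C2*x^2 + C4*x + C6))"
      unfolding k6_def k3_def k4_def k2_def k1_def by algebra
    then show ?thesis using h'[of y x] by simp
  qed
  have k0: "k6 = 0" "k3 = 0" using k[where x = 0 and y = 0] k[where x = 0 and y = 1] by simp_all
  have k5: "k4 = 0" "k2 = 0" using k0 k[where x = 1 and y = 0] k[where x = "-1" and y = 0] by simp_all
  have "k1 = 0" using k0 k5 k[where x = 1 and y = 1] by simp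
  note e = k0 k5 this
  note e = e[unfolded k6_def k3_def k4_def k2_def k1_def]
  define B1 where "B1 = A1 + 2*s"
  define B2 where "B2 = A2 - s*A1 + 3*r - s^2"
  define B3 where "B3 = A3 + r*A1 + 2*t"
  define B4 where "B4 = A4 - s*A3 + 2*r*A2 - (t + r*s)*A1 + 3*r^2 - 2*s*t"
  define B6 where "B6 = A6 + r*A4 + r^2*A2 + r^3 - t*A3 - t^2 - r*t*A1"
  note e' = e[folded B1_def B2_def B3_def B4_def B6_def]
  have "u^5 * B1 = u^5 * (u * C1)" "u^4 * B2 = u^4 * (u^2 * C2)" "u^3 * B3 = u^3 * (u^3 * C3)"
    "u^2 * B4 = u^2 * (u^4 * C4)"
    using e' by (auto simp: eval_nat_numeral mult.assoc)
  then have f: "B1 = u * C1" "B2 = u^2 * C2" "B3 = u^3 * C3" "B4 = u^4 * C4"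
    unfolding mult_cancel_left using u by simp_all
  have f6: "B6 = u^6 * C6" using e' by simp
  define b2 where "b2 = A1^2 + 4 * A2"
  define b4 where "b4 = 2 * A4 + A1 * A3"
  define b6 where "b6 = A3^2 + 4 * A6"
  define b8 where "b8 = A1^2 * A6 + 4 * A2 * A6 - A1 * A3 * A4 + A2 * A3^2 - A4^2"
  have b8: "4 * b8 = b2 * b6 - b4^2"
    unfolding b2_def b4_def b6_def b8_def by algebra
  have g2: "B1^2 + 4 * B2 = b2 + 12*r"
    unfolding B1_def B2_def b2_def by algebra
  have g4: "2 * B4 + B1 * B3 = b4 + r*b2 + 6*r^2"
    unfolding B1_def B2_def B3_def B4_def b2_def b4_def by algebra
  have g6: "B3^2 + 4 * B6 = b6 + 2*r*b4 + r^2*b2 + 4*r^3"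
    unfolding B1_def B2_def B3_def B4_def B6_def b2_def b4_def b6_def by algebra
  have "4 * (B1^2 * B6 + 4 * B2 * B6 - B1 * B3 * B4 + B2 * B3^2 - B4^2)
      = (B1^2 + 4 * B2) * (B3^2 + 4 * B6) - (2 * B4 + B1 * B3)^2" by algebra
  also have "\<dots> = 4 * (b8 + 3*r*b6 + 3*r^2*b4 + r^3*b2 + 3*r^4)"
    unfolding g2 g4 g6 using b8 by algebra
  finally have g8: "B1^2 * B6 + 4 * B2 * B6 - B1 * B3 * B4 + B2 * B3^2 - B4^2
      = b8 + 3*r*b6 + 3*r^2*b4 + r^3*b2 + 3*r^4" by simp
  have "4 * discriminant (Weierstrass B1 B2 B3 B4 B6) = 4 * discriminant E"
    unfolding E discriminant_def Let_def weierstrass_curve.sel g2 g4 g6 g8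
      b2_def[symmetric] b4_def[symmetric] b6_def[symmetric] b8_def[symmetric]
    using b8 by algebra
  moreover have "discriminant (Weierstrass B1 B2 B3 B4 B6) = u^12 * discriminant E'"
    unfolding E' discriminant_def Let_def weierstrass_curve.sel f f6 by algebra
  ultimately have "discriminant E = u^12 * discriminant E'" by simp
  with u show ?thesis by blast
qed

lemma Q_isomorphic_short_ex: "\<exists>A B. Q_isomorphic E (short_weierstrass A B)"
proof -
  obtain A1 A2 A3 A4 A6 where E: "E = Weierstrass A1 A2 A3 A4 A6" by (cases E)
  define s where "s = - A1 / 2"
  define r where "r = - (A2 - s*A1 - s^2) / 3"
  define t where "t = - (A3 + r*A1) / 2"
  define p where "p = A4 - s*A3 + 2*r*A2 - (t + r*s)*A1 + 3*r^2 - 2*s*t"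
  define q where "q = A6 + r*A4 + r^2*A2 + r^3 - t*A3 - t^2 - r*t*A1"
  obtain i j where p: "p = of_int i / of_int j" and j: "j > 0"
    by (metis quotient_of_div quotient_of_denom_pos surj_pair)
  obtain k l where q: "q = of_int k / of_int l" and l: "l > 0"
    by (metis quotient_of_div quotient_of_denom_pos surj_pair)
  define u :: rat where "u = 1 / of_int (j * l)"
  have u: "u \<noteq> 0" using j l by (simp add: u_def)
  have pe: "p = u^4 * of_int (i * j^3 * l^4)"
    using j l unfolding p u_def by (simp add: field_simps eval_nat_numeral)
  have qe: "q = u^6 * of_int (k * j^6 * l^5)"
    using j l unfolding q u_def by (simp add: field_simps eval_nat_numeral)
  have z: "A1 + 2*s = 0" "A2 - s*A1 + 3*r - s^2 = 0" "A3 + r*A1 + 2*t = 0"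
    by (simp_all add: s_def r_def t_def field_simps)
  have "weierstrass_eqn E (u^2 * x + r) (u^3 * y + s * u^2 * x + t)
        = u^6 * weierstrass_eqn (short_weierstrass (i * j^3 * l^4) (k * j^6 * l^5)) x y" for x y
  proof -
    have "weierstrass_eqn E (u^2 * x + r) (u^3 * y + s * u^2 * x + t)
        = u^6 * y^2 - u^6 * x^3 - u^2 * x * p - q"
      unfolding E weierstrass_eqn_def weierstrass_curve.sel p_def q_def using z by algebra
    then show ?thesis
      unfolding pe qe short_weierstrass_def weierstrass_eqn_def weierstrass_curve.sel by algebra
  qed
  with u show ?thesis unfolding Q_isomorphic_def by blast
qed

lemma sqrt_disc_rational_short:
  assumes "Q_isomorphic E (short_weierstrass A B)"
  shows "(\<exists>q::rat. q^2 = of_int (short_disc A B)) \<longleftrightarrow> (\<exists>q. q^2 = discriminant E)"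
proof -
  obtain u where u: "u \<noteq> 0" and h: "discriminant E = u^12 * of_int (short_disc A B)"
    using Q_isomorphic_discriminant[OF assms] unfolding discriminant_short by blast
  show ?thesis
  proof
    assume "\<exists>q::rat. q^2 = of_int (short_disc A B)"
    then obtain q :: rat where "q^2 = of_int (short_disc A B)" by blast
    then have "(u^6 * q)^2 = discriminant E" unfolding h by (simp add: power_mult_distrib)
    then show "\<exists>q. q^2 = discriminant E" by blast
  next
    assume "\<exists>q. q^2 = discriminant E"
    then obtain q where "q^2 = discriminant E" by blast
    then have "(q / u^6)^2 = of_int (short_disc A B)"
      using u unfolding h by (simp add: power_divide)
    then show "\<exists>q::rat. q^2 = of_int (short_disc A B)" by blast
  qed
qed

lemma sqrt_disc_rational_iff: "sqrt_disc_rational E \<longleftrightarrow> (\<exists>q. q^2 = discriminant E)"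
  unfolding sqrt_disc_rational_def using Q_isomorphic_short_ex sqrt_disc_rational_short by blast

end

theory Submission
  imports Defs
begin

text \<open>
  A point of order 3 is a flex. Moving it to the origin, with its tangent line as the axis
  \<open>y = 0\<close>, brings the curve into the form \<open>y\<^sup>2 + A x y + B y = x\<^sup>3\<close>
  (\<open>three_torsion_normal_form\<close>), whose discriminant is \<open>B\<^sup>3 (A\<^sup>3 - 27 B)\<close>. If this is a
  nonzero square then \<open>B (A\<^sup>3 - 27 B) = w\<^sup>2\<close> for some rational \<open>w\<close>. Here \<open>A \<noteq> 0\<close>, because
  \<open>-27\<close> is not a rational square, so the \<open>\<rat>\<close>-isomorphism class depends only on
  \<open>B / A\<^sup>3\<close>. The equation is that of a conic with a rational point, and in terms of the
  parameter \<open>m = w / B\<close> it reads \<open>A\<^sup>3 / B = m\<^sup>2 + 27\<close>.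

  On the other side, \<open>E1 a b c d\<close> is, up to the scaling by \<open>N M\<close>, a curve that depends only on
  the quotient \<open>T\<^sup>2 / (N M\<^sup>3)\<close>, and it has the above normal form with
  \<open>36 B / A\<^sup>3 = T\<^sup>2 / (N M\<^sup>3)\<close>. For \<open>a = 1\<close> and \<open>b = 0\<close> this quotient is
  \<open>d\<^sup>2 / (c\<^sup>2 + c d + d\<^sup>2)\<close>. Completing the square,
  \<open>36 (c\<^sup>2 + c d + d\<^sup>2) / d\<^sup>2 = (6 c / d + 3)\<^sup>2 + 27\<close>, so that \<open>c / d = (m - 3) / 6\<close> gives the
  wanted curve. Thus the members of the first family with \<open>a = 1\<close>, \<open>b = 0\<close> already
  represent every isomorphism class.
\<close>

lemma Q_isomorphic_trans:
  assumes "Q_isomorphic E E'" and "Q_isomorphic E' E''"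
  shows "Q_isomorphic E E''"
proof -
  obtain u r s t where u: "u \<noteq> 0" and
    h: "\<And>x y. weierstrass_eqn E (u^2 * x + r) (u^3 * y + s * u^2 * x + t)
              = u^6 * weierstrass_eqn E' x y"
    using assms(1) unfolding Q_isomorphic_def by blast
  obtain v r' s' t' where v: "v \<noteq> 0" and
    h': "\<And>x y. weierstrass_eqn E' (v^2 * x + r') (v^3 * y + s' * v^2 * x + t')
              = v^6 * weierstrass_eqn E'' x y"
    using assms(2) unfolding Q_isomorphic_def by blast
  have "weierstrass_eqn E ((u * v)^2 * x + (u^2 * r' + r))
          ((u * v)^3 * y + (u * s' + s) * (u * v)^2 * x + (u^3 * t' + s * u^2 * r' + t))
        = (u * v)^6 * weierstrass_eqn E'' x y" for x y
  proof -
    have x: "(u * v)^2 * x + (u^2 * r' + r) = u^2 * (v^2 * x + r') + r"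
      by algebra
    have y: "(u * v)^3 * y + (u * s' + s) * (u * v)^2 * x + (u^3 * t' + s * u^2 * r' + t)
        = u^3 * (v^3 * y + s' * v^2 * x + t') + s * u^2 * (v^2 * x + r') + t"
      by algebra
    show ?thesis
      unfolding x y h h' by (simp add: power_mult_distrib)
  qed
  moreover have "u * v \<noteq> 0" using u v by simp
  ultimately show ?thesis unfolding Q_isomorphic_def by blast
qed

text \<open>
  That \<open>3 P\<close> vanishes says that \<open>2 P\<close>, the negative of the third intersection point of the
  tangent at \<open>P\<close>, equals \<open>-P\<close>; comparing \<open>x\<close>-coordinates gives the first equation, which says
  that this tangent meets the curve only in \<open>P\<close>. The number \<open>2 y + a1 x + a3\<close> is nonzero because
  \<open>2 P\<close> does not vanish, so the tangent is not vertical and has a slope \<open>l\<close>.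
\<close>

lemma order_three_flex:
  assumes P: "has_order E P 3"
  obtains x y l where "P = Affine x y"
    and "l^2 + a1 E * l - a2 E = 3 * x"
    and "2 * y + a1 E * x + a3 E \<noteq> 0"
    and "l * (2 * y + a1 E * x + a3 E) = 3 * x^2 + 2 * a2 E * x + a4 E - a1 E * y"
proof -
  have m: "point_multiple E 1 P \<noteq> Infinity" "point_multiple E 2 P \<noteq> Infinity"
    "point_multiple E 3 P = Infinity"
    using P unfolding has_order_def by auto
  obtain x y where Pxy: "P = Affine x y"
    using m(1) by (cases P) (auto simp: point_multiple_def)
  define l where "l = (3 * x^2 + 2 * a2 E * x + a4 E - a1 E * y) / (2 * y + a1 E * x + a3 E)"
  have m2: "point_add E P P \<noteq> Infinity"
    using m(2) by (simp add: point_multiple_def numeral_2_eq_2 Pxy)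
  have m3: "point_add E P (point_add E P P) = Infinity"
    using m(3) by (simp add: point_multiple_def numeral_3_eq_3 Pxy)
  have B: "2 * y + a1 E * x + a3 E \<noteq> 0"
    using m2 by (auto simp: Pxy)
  define x3 where "x3 = l^2 + a1 E * l - a2 E - x - x"
  obtain y3 where dbl: "point_add E P P = Affine x3 y3"
    using B unfolding Pxy by (simp add: Let_def l_def[symmetric] x3_def)
  have "point_add E (Affine x y) (Affine x3 y3) = Infinity"
    using m3 unfolding dbl by (simp only: Pxy)
  then have "x3 = x"
    by (auto simp: Let_def split: if_splits)
  then have "l^2 + a1 E * l - a2 E = 3 * x"
    unfolding x3_def by simp
  moreover have "l * (2 * y + a1 E * x + a3 E) = 3 * x^2 + 2 * a2 E * x + a4 E - a1 E * y"
    using B unfolding l_def by simp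
  ultimately show thesis
    using that Pxy B by blast
qed

lemma three_torsion_normal_form:
  assumes "P \<in> rational_points E" and "has_order E P 3"
  obtains A B where "Q_isomorphic E (Weierstrass A 0 B 0 0)"
proof -
  obtain x0 y0 l where P: "P = Affine x0 y0"
    and flex: "l^2 + a1 E * l - a2 E = 3 * x0"
    and slope: "l * (2 * y0 + a1 E * x0 + a3 E) = 3 * x0^2 + 2 * a2 E * x0 + a4 E - a1 E * y0"
    using order_three_flex[OF assms(2)] by metis
  have on_curve: "weierstrass_eqn E x0 y0 = 0"
    using assms(1) by (simp add: P rational_points_def)
  obtain A1 A2 A3 A4 A6 where E: "E = Weierstrass A1 A2 A3 A4 A6" by (cases E)
  \<comment> \<open>The change of variables sends the flex to the origin and its tangent to \<open>y = 0\<close>.\<close>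
  have "weierstrass_eqn E (1^2 * x + x0) (1^3 * y + l * 1^2 * x + y0)
      = 1^6 * weierstrass_eqn (Weierstrass (A1 + 2 * l) 0 (2 * y0 + A1 * x0 + A3) 0 0) x y" for x y
    using flex slope on_curve
    unfolding E weierstrass_eqn_def weierstrass_curve.sel power_one mult_1 mult_1_right by algebra
  then have "Q_isomorphic E (Weierstrass (A1 + 2 * l) 0 (2 * y0 + A1 * x0 + A3) 0 0)"
    unfolding Q_isomorphic_def by (metis zero_neq_one)
  then show thesis by (rule that)
qed

lemma discriminant_normal_form:
  "discriminant (Weierstrass A 0 B 0 0) = B^3 * (A^3 - 27 * B)"
  by (simp add: discriminant_def Let_def algebra_simps eval_nat_numeral)

text \<open>
  Completing the square and the cube turns the normal form into \<open>Y\<^sup>2 = X\<^sup>3 + p X + q\<close> with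
  \<open>48 p = -A (A\<^sup>3 - 24 B)\<close> and \<open>864 q = A\<^sup>6 - 36 A\<^sup>3 B + 216 B\<^sup>2\<close>. Substituting
  \<open>36 B = A\<^sup>3 d\<^sup>2 / N\<close>, these become \<open>u\<^sup>4\<close> and \<open>u\<^sup>6\<close> times the coefficients of \<open>E1 1 0 c d\<close>
  for \<open>u = A / (6 N)\<close>.
\<close>

lemma normal_form_isomorphic_E1:
  fixes A B :: rat and c d :: int
  assumes A: "A \<noteq> 0" and d: "d \<noteq> 0"
    and param: "A^3 * of_int d^2 = 36 * B * of_int (N_form c d)"
  shows "Q_isomorphic (Weierstrass A 0 B 0 0) (E1 1 0 c d)"
proof -
  define D :: rat where "D = of_int d"
  define N :: rat where "N = of_int (N_form c d)"
  have param': "A^3 * D^2 = 36 * B * N"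
    using param by (simp add: D_def N_def)
  have N0: "N \<noteq> 0"
    using A d param' by (auto simp: D_def)
  define u where "u = A / (6 * N)"
  have u0: "u \<noteq> 0" using A N0 by (simp add: u_def)
  have uA: "A = 6 * N * u" using N0 by (simp add: u_def)
  have uB: "B = 6 * N^2 * D^2 * u^3"
  proof -
    have "36 * N * B = 36 * N * (6 * N^2 * D^2 * u^3)"
      using param' unfolding uA by algebra
    then show ?thesis using N0 by simp
  qed
  define p where "p = - (9 * N^3 * (3 * N - 2 * D^2))"
  define q where "q = 9 * N^4 * (6 * N^2 - 6 * N * D^2 + D^4)"
  have E1: "E1 1 0 c d = Weierstrass 0 0 0 p q"
    by (simp add: E1_def Let_def M_form_def T_form_def short_weierstrass_def
        p_def q_def N_def D_def)
  define r where "r = - 3 * N^2 * u^2"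
  define s where "s = - 3 * N * u"
  define t where "t = - 3 * N^2 * D^2 * u^3 + 9 * N^3 * u^3"
  have "weierstrass_eqn (Weierstrass A 0 B 0 0) (u^2 * x + r) (u^3 * y + s * u^2 * x + t)
      = u^6 * weierstrass_eqn (E1 1 0 c d) x y" for x y
    unfolding E1 weierstrass_eqn_def weierstrass_curve.sel uA uB r_def s_def t_def p_def q_def
    by algebra
  with u0 show ?thesis unfolding Q_isomorphic_def by blast
qed

lemma square_discriminant_parameters:
  fixes A B q :: rat
  assumes square: "q^2 = B^3 * (A^3 - 27 * B)" and B: "B \<noteq> 0"
  obtains c d :: int where "A \<noteq> 0" and "d \<noteq> 0"
    and "A^3 * of_int d^2 = 36 * B * of_int (N_form c d)"
proof -
  have A: "A \<noteq> 0"
  proof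
    assume "A = 0"
    then have "q^2 + 27 * (B^2)^2 = 0" using square by algebra
    moreover have "0 \<le> q^2" "0 < (B^2)^2" using B by simp_all
    ultimately show False by linarith
  qed
  \<comment> \<open>With \<open>w = q / B\<close> the parameter \<open>w / B\<close> of the conic is \<open>q / B\<^sup>2\<close>.\<close>
  define m where "m = q / B^2"
  have q: "q = m * B^2" using B by (simp add: m_def)
  have m: "A^3 = B * (m^2 + 27)"
  proof -
    have "B^3 * A^3 = B^3 * (B * (m^2 + 27))" using square unfolding q by algebra
    then show ?thesis using B by simp
  qed
  obtain c d where cd: "(m - 3) / 6 = of_int c / of_int d" and d: "d > 0"
    by (metis quotient_of_div quotient_of_denom_pos surj_pair)
  have "m * of_int d = 6 * of_int c + 3 * of_int d"
    using cd d by (simp add: field_simps)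
  then have "A^3 * of_int d^2 = 36 * B * of_int (N_form c d)"
    unfolding m N_form_def of_int_add of_int_mult of_int_power by algebra
  with A d show thesis using that by (metis less_irrefl)
qed

theorem proposition1:
  fixes E :: weierstrass_curve
  assumes "elliptic_curve E"
    and "\<exists>P \<in> rational_points E. has_order E P 3"
    and "sqrt_disc_rational E"
  shows "\<exists>a b c d :: int.
           (elliptic_curve (E1 a b c d) \<and> Q_isomorphic E (E1 a b c d)) \<or>
           (elliptic_curve (E2 a b c d) \<and> Q_isomorphic E (E2 a b c d))"
proof -
  obtain A B where iso: "Q_isomorphic E (Weierstrass A 0 B 0 0)"
    using assms(2) three_torsion_normal_form by metis
  obtain u where u: "u \<noteq> 0"
    and disc: "discriminant E = u^12 * (B^3 * (A^3 - 27 * B))"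
    using Q_isomorphic_discriminant[OF iso] unfolding discriminant_normal_form by blast
  have B: "B \<noteq> 0"
    using assms(1) disc by (auto simp: elliptic_curve_def)
  obtain q where "q^2 = discriminant E"
    using assms(3) sqrt_disc_rational_iff by blast
  then have "(q / u^6)^2 = B^3 * (A^3 - 27 * B)"
    using u unfolding disc by (simp add: power_divide)
  then obtain c d where "A \<noteq> 0" "d \<noteq> 0" "A^3 * of_int d^2 = 36 * B * of_int (N_form c d)"
    using square_discriminant_parameters B by metis
  then have "Q_isomorphic E (E1 1 0 c d)"
    using Q_isomorphic_trans[OF iso] normal_form_isomorphic_E1 by blast
  moreover from this have "elliptic_curve (E1 1 0 c d)"
    using assms(1) Q_isomorphic_discriminant unfolding elliptic_curve_def by fastforce
  ultimately show ?thesis by blast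
qed

end
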